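(* Let $m,n,r$ be positive integers with $rm\le n$, let $q=2^m$, let $G(x)=G_0+G_1x+\dots+G_rx^r\in\mathbb{F}_q[x]$ have degree $r$, and let $\mathcal{L}=\{f_1(x),\dots,f_n(x)\}$ be a set of $n$ polynomials irreducible over $\mathbb{F}_q$, with $\gcd(f_i(x),f_j(x))=1$ for all $i\ne j$ and $\gcd(f_i(x),G(x))=1$ for all $i$. Write $f_i(x)=\prod_{j=0}^{l_i-1}\bigl(x-\gamma_i^{q^j}\bigr)$, where $l_i=\deg f_i$ and $\gamma_i^{q^j}\in\mathbb{F}_{q^{l_i}}$ $(0\le j\le l_i-1)$ are the roots of $f_i$. Define the $r\times n$ matrix $\mathbf{H}$ whose $i$-th column ($1\le i\le n$) is $(h_{i,1},h_{i,2},\dots,h_{i,r})^\top$, where $$h_{i,j}=\sum_{\iota=0}^{l_i-1}\frac{\gamma_i^{(j-1)q^{\iota}}}{G\bigl(\gamma_i^{q^{\iota}}\bigr)},\qquad 1\le i\le n,\ 1\le j\le r.$$ Then $\mathbf{H}\in\mathbb{F}_q^{r\times n}$ and $\mathbf{H}$ is a parity-check matrix of the binary generalized Goppa code $\Gamma(\mathcal{L},G)$, i.e. for $\mathbf{c}\in\mathbb{F}_2^n$ one has $\mathbf{c}\in\Gamma(\mathcal{L},G)$ if and only if $\mathbf{H}\mathbf{c}^\top=\mathbf{0}$.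
   Context: For $\mathcal{L}=\{f_1,\dots,f_n\}$ and $G$ as in the claim, the binary generalized Goppa code with code locators $\mathcal{L}$ and Goppa polynomial $G$ is $$\Gamma(\mathcal{L},G)=\Bigl\{\mathbf{c}\in\mathbb{F}_2^n : \sum_{i=1}^n c_i\frac{f_i'(x)}{f_i(x)}= 0 \bmod G(x)\Bigr\},$$ where $f_i'$ is the formal derivative of $f_i$ and $1/f_i(x)$ is interpreted as the inverse of $f_i(x)$ in $\mathbb{F}_q[x]/(G(x))$. Vectors are row vectors. Since $\gcd(f_i,G)=1$, $G(\gamma_i^{q^\iota})\neq 0$, so the entries $h_{i,j}$ are well defined. The convention $\gamma^0=1$ is used for $j=1$. *)

theory Defs
  imports
    "HOL-Library.Z2"
    "HOL-Library.Cardinality"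
    "HOL-Computational_Algebra.Polynomial"
    "HOL-Number_Theory.Cong"
    "HOL-Algebra.Algebraic_Closure_Type"
    "Jordan_Normal_Form.Matrix"
begin

text \<open>
  The ground field with \<open>q\<close> elements is a finite field type \<open>'a\<close>. All its extensions of degree
  \<open>l\<close> are realised inside the single field \<open>'a alg_closure\<close>, where the one of degree \<open>l\<close> is
  the set of fixed points of \<open>x \<mapsto> x ^ (q ^ l)\<close>; \<^const>\<open>to_ac\<close> is the embedding of \<open>'a\<close>.
\<close>

definition ext_field :: "nat \<Rightarrow> 'a :: {field, finite} alg_closure set" where
  "ext_field l = {x. x ^ (CARD('a) ^ l) = x}"

text \<open>
  The inverse of the class of \<open>f\<close> in \<open>'a[x]/(G)\<close>, given by its reduced representative.
  It is meaningful only if \<open>f\<close> and \<open>G\<close> are coprime.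
\<close>

definition inverse_mod :: "'a :: field poly \<Rightarrow> 'a poly \<Rightarrow> 'a poly" where
  "inverse_mod G f = (THE u. u mod G = u \<and> [f * u = 1] (mod G))"

text \<open>
  Code locators and coordinates are indexed from \<open>0\<close>, matching \<^typ>\<open>bit vec\<close>.
  The abbreviation \<open>of_bit\<close> embeds the field with two elements; it is a homomorphism
  only into rings of characteristic 2.
\<close>

definition generalized_goppa_code ::
    "nat \<Rightarrow> (nat \<Rightarrow> 'a :: field poly) \<Rightarrow> 'a poly \<Rightarrow> bit vec set" where
  "generalized_goppa_code n f G =
     {c \<in> carrier_vec n.
        [(\<Sum>i<n. smult (of_bit (c $ i)) (pderiv (f i) * inverse_mod G (f i))) = 0] (mod G)}"

text \<open>
  Row \<open>j\<close> here is row \<open>j + 1\<close> in the usual numbering from \<open>1\<close>, so the exponent \<open>j - 1\<close> becomes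
  \<open>j\<close>. The convention \<open>\<gamma> ^ 0 = 1\<close> also for \<open>\<gamma> = 0\<close> is that of \<open>(^)\<close>.
\<close>

definition goppa_matrix ::
    "nat \<Rightarrow> nat \<Rightarrow> (nat \<Rightarrow> 'a :: {field, finite} poly) \<Rightarrow> (nat \<Rightarrow> 'a alg_closure) \<Rightarrow> 'a poly
       \<Rightarrow> 'a alg_closure mat" where
  "goppa_matrix r n f \<gamma> G =
     mat r n (\<lambda>(j, i). \<Sum>\<iota><degree (f i).
        \<gamma> i ^ (j * CARD('a) ^ \<iota>) / poly (map_poly to_ac G) (\<gamma> i ^ (CARD('a) ^ \<iota>)))"

end

theory Submission
  imports
    Defs
    "HOL-Number_Theory.Residues"
    "Jordan_Normal_Form.Char_Poly"
begin

text \<open>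
  For a root \<open>a\<close> of a locator, \<open>G(x) - G(a) = (x - a) S(x)\<close> shows that \<open>- S / G(a)\<close> inverts \<open>x - a\<close>
  modulo \<open>G\<close>, where \<open>S\<close> is the quotient given by synthetic division. Hence the logarithmic derivative
  \<open>f' / f\<close>, the sum of the \<open>1 / (x - a)\<close> over the roots \<open>a\<close> of \<open>f\<close>, is congruent to a combination of
  such quotients, whose degree is below \<open>deg G\<close>. The congruence defining the code therefore becomes the
  vanishing of a polynomial, and its coefficients arise from the entries of \<open>H c\<close> by a triangular
  matrix with the leading coefficient of \<open>G\<close> on the diagonal. The entries of \<open>H\<close> lie in the ground
  field because Frobenius permutes the roots of each locator cyclically.
\<close>

section \<open>Inverses modulo a polynomial\<close>

text \<open>Euclid's algorithm: a Bezout identity for \<open>q\<close> and \<open>p mod q\<close>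
  turns into one for \<open>p\<close> and \<open>q\<close>, and the Euclidean size of the second
  argument drops.\<close>

lemma coprime_bezout:
  fixes p q :: "'a :: euclidean_ring"
  assumes "coprime p q"
  shows "\<exists>u v. p * u + q * v = 1"
  using assms
proof (induction "euclidean_size q" arbitrary: p q rule: less_induct)
  case less
  show ?case
  proof (cases "q = 0")
    case True
    with less.prems have "p dvd 1" by simp
    then obtain u where "1 = p * u" by (rule dvdE)
    with True show ?thesis by auto
  next
    case False
    have "coprime q (p mod q)"
      using less.prems by (auto simp: coprime_def dvd_mod_iff)
    with less.hyps[of "p mod q" q] False obtain u v where "q * u + (p mod q) * v = 1"
      by (auto simp: mod_size_less)
    then have "p * v + q * (u - (p div q) * v) = 1"
      by (simp add: algebra_simps flip: minus_div_mult_eq_mod)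
    then show ?thesis by blast
  qed
qed

text \<open>Justifies the definite description: a Bezout coefficient reduced modulo \<open>G\<close>
  exists, and any other inverse \<open>w\<close> satisfies \<open>w = w (f u) = u (f w) = u\<close>
  modulo \<open>G\<close>.\<close>

lemma cong_inverse_mod:
  fixes f G :: "'a :: field poly"
  assumes "coprime f G"
  shows "[f * inverse_mod G f = 1] (mod G)"
proof -
  obtain u v where uv: "f * u + G * v = 1"
    using coprime_bezout[OF assms] by blast
  have "f * u - 1 = G * (- v)"
    by (simp flip: uv)
  then have fu: "[f * u = 1] (mod G)"
    by (simp add: cong_iff_dvd_diff)
  have "\<exists>!w. w mod G = w \<and> [f * w = 1] (mod G)"
  proof (rule ex1I[of _ "u mod G"])
    show "u mod G mod G = u mod G \<and> [f * (u mod G) = 1] (mod G)"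
      using fu by (simp add: cong_def mod_mult_right_eq)
  next
    fix w assume w: "w mod G = w \<and> [f * w = 1] (mod G)"
    have "[w = w * (f * u)] (mod G)"
      using cong_scalar_left[OF cong_sym[OF fu], of w] by simp
    also have "w * (f * u) = u * (f * w)" by (simp add: ac_simps)
    also have "[u * (f * w) = u] (mod G)"
      using w cong_scalar_left[of "f * w" 1 G u] by simp
    finally show "w = u mod G" using w by (simp add: cong_def)
  qed
  from theI'[OF this] show ?thesis by (simp add: inverse_mod_def)
qed

section \<open>Synthetic division and logarithmic derivatives\<close>

lemma coeff_synthetic_div:
  fixes p :: "'a :: comm_semiring_1 poly"
  shows "degree p \<le> N \<Longrightarrow> coeff (synthetic_div p c) t = (\<Sum>s<N. coeff p (t + 1 + s) * c ^ s)"
proof (induction p arbitrary: t)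
  case (pCons a p)
  show ?case
  proof (cases t)
    case 0
    have "poly p c = (\<Sum>s<N. coeff p s * c ^ s)"
    proof (cases "p = 0")
      case False
      with pCons.prems have "degree p < N" by simp
      then show ?thesis
        unfolding poly_altdef by (intro sum.mono_neutral_left) (auto simp: coeff_eq_0)
    qed simp
    with 0 show ?thesis by simp
  next
    case (Suc t')
    have "degree p \<le> N" using pCons.prems by (cases "p = 0") auto
    with pCons.IH[of t'] Suc show ?thesis by simp
  qed
qed simp

text \<open>Such combinations are already reduced modulo \<open>g\<close>, so divisibility by
  \<open>g\<close> will mean that they vanish.\<close>

lemma degree_sum_synthetic_div_less:
  assumes "degree g > 0"
  shows "degree (\<Sum>x\<in>A. smult (w x) (synthetic_div g (a x))) < degree g"
proof -
  have "degree (\<Sum>x\<in>A. smult (w x) (synthetic_div g (a x))) \<le> degree g - 1"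
    by (induction A rule: infinite_finite_induct)
      (auto intro!: degree_add_le order_trans[OF degree_smult_le] simp: degree_synthetic_div)
  with assms show ?thesis by simp
qed

lemma sum_synthetic_div_eq_0_iff:
  fixes g :: "'k :: field poly"
  assumes "degree g > 0"
  shows "(\<Sum>x\<in>A. smult (w x) (synthetic_div g (a x))) = 0 \<longleftrightarrow>
    (\<forall>j<degree g. (\<Sum>x\<in>A. w x * a x ^ j) = 0)"
proof -
  let ?r = "degree g" and ?P = "\<Sum>x\<in>A. smult (w x) (synthetic_div g (a x))"
  define h where "h j = (\<Sum>x\<in>A. w x * a x ^ j)" for j
  have coeff: "coeff ?P t = (\<Sum>s<?r. coeff g (t + 1 + s) * h s)" for t
    unfolding h_def sum_distrib_left
    by (subst sum.swap)
      (simp add: coeff_sum coeff_synthetic_div[OF order_refl] sum_distrib_left ac_simps)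
  have "h j = 0" if P: "?P = 0" and "j < ?r" for j
    using \<open>j < ?r\<close>
  proof (induction j rule: less_induct)
    case (less j)
    \<comment> \<open>In the coefficient of index \<open>?r - 1 - j\<close>, terms with
      \<open>s > j\<close> involve coefficients of \<open>g\<close> beyond its degree, and those
      with \<open>s < j\<close> vanish by induction; only the leading coefficient times
      \<open>h j\<close> remains.\<close>
    have "0 = (\<Sum>s<?r. coeff g (?r - 1 - j + 1 + s) * h s)"
      using coeff[of "?r - 1 - j"] P by simp
    also have "\<dots> = (\<Sum>s<?r. if s = j then coeff g ?r * h j else 0)"
    proof (rule sum.cong)
      fix s assume "s \<in> {..<?r}"
      consider "s < j" | "s = j" | "s > j" by linarith
      then show "coeff g (?r - 1 - j + 1 + s) * h s = (if s = j then coeff g ?r * h j else 0)"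
        using less by cases (auto simp: coeff_eq_0)
    qed simp
    also have "\<dots> = coeff g ?r * h j" using less.prems by simp
    finally show ?case using assms by auto
  qed
  moreover have "?P = 0" if "\<forall>j<?r. h j = 0"
    by (rule poly_eqI) (simp only: coeff, simp add: that)
  ultimately show ?thesis unfolding h_def by blast
qed

text \<open>By the product rule, \<open>pderiv F\<close> is the sum of the products that omit one
  linear factor; times \<open>u\<close>, each becomes the inverse of the omitted factor.\<close>

lemma pderiv_mult_inverse_cong:
  fixes g u :: "'k :: field poly"
  assumes "finite A" and F: "F = (\<Prod>j\<in>A. [:- a j, 1:])" and inv: "[F * u = 1] (mod g)"
    and nz: "\<And>j. j \<in> A \<Longrightarrow> poly g (a j) \<noteq> 0"
  shows "[pderiv F * u = - (\<Sum>j\<in>A. smult (1 / poly g (a j)) (synthetic_div g (a j)))] (mod g)"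
proof -
  have "[(\<Prod>i\<in>A - {j}. [:- a i, 1:]) * u = - smult (1 / poly g (a j)) (synthetic_div g (a j))] (mod g)"
    if j: "j \<in> A" for j
  proof -
    let ?X = "[:- a j, 1:]" and ?P = "\<Prod>i\<in>A - {j}. [:- a i, 1:]"
    let ?s = "- smult (1 / poly g (a j)) (synthetic_div g (a j))"
    have "smult (1 / poly g (a j)) g =
        smult (1 / poly g (a j)) (?X * synthetic_div g (a j) + [:poly g (a j):])"
      by (simp only: synthetic_div_correct')
    also have "\<dots> = 1 - ?X * ?s"
      using nz[OF j] by (simp add: smult_add_right one_pCons)
    finally have "[?X * ?s = 1] (mod g)"
      by (metis cong_iff_dvd_diff cong_sym dvd_refl dvd_smult)
    \<comment> \<open>Inserting \<open>?X * ?s\<close>, which is 1 modulo \<open>g\<close>, restores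
      the missing factor of \<open>F\<close>, and then \<open>F * u\<close> cancels.\<close>
    then have "[?P * u = ?P * u * (?X * ?s)] (mod g)"
      using cong_scalar_left[OF cong_sym, of "?X * ?s" 1 g "?P * u"] by (simp only: mult_1_right)
    also have "?P * u * (?X * ?s) = F * u * ?s"
      unfolding F prod.remove[OF \<open>finite A\<close> j] by (simp only: ac_simps)
    also have "[F * u * ?s = ?s] (mod g)"
      using cong_scalar_right[OF inv, of ?s] by (simp only: mult_1_left)
    finally show ?thesis .
  qed
  then show ?thesis
    unfolding F pderiv_prod sum_negf[symmetric] sum_distrib_right
    by (intro cong_sum) (simp add: pderiv_pCons)
qed

section \<open>Finite fields inside their algebraic closure\<close>

interpretation to_ac: field_hom to_ac
  by unfold_locales simp_all

lemma to_ac_of_bool [simp]: "to_ac (of_bool b) = of_bool b"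
  by (cases b) simp_all

text \<open>Multiplication by a nonzero \<open>x\<close> permutes the nonzero elements; comparing
  their products gives the claim.\<close>

lemma finite_field_power_CARD:
  fixes x :: "'a :: {field, finite}"
  shows "x ^ CARD('a) = x"
proof (cases "x = 0")
  case False
  let ?U = "UNIV - {0 :: 'a}"
  have "bij_betw ((*) x) ?U ?U"
    by (rule bij_betwI[where g = "\<lambda>y. y / x"]) (use False in auto)
  then have "\<Prod>?U = (\<Prod>y\<in>?U. x * y)"
    by (rule prod.reindex_bij_betw[where g = "\<lambda>y. y", symmetric])
  also have "\<dots> = x ^ (CARD('a) - 1) * \<Prod>?U"
    by (simp add: prod.distrib card_Diff_singleton)
  finally have "x ^ (CARD('a) - 1) = 1" by simp
  then show ?thesis
    by (metis mult_1_right power_eq_if zero_less_card_finite less_not_refl)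
qed simp

text \<open>With \<open>q = CARD('a)\<close>, the polynomial \<open>x^q - x\<close> has at most
  \<open>q\<close> roots, and the \<open>q\<close> embedded elements are among them.\<close>

lemma range_to_ac_iff:
  fixes x :: "'a :: {field, finite} alg_closure"
  shows "x \<in> range to_ac \<longleftrightarrow> x ^ CARD('a) = x"
proof -
  let ?p = "monom 1 (CARD('a)) - [:0, 1:] :: 'a alg_closure poly"
  have "CARD('a) > 1"
    using card_mono[of UNIV "{0, 1 :: 'a}"] by simp
  then have deg: "degree ?p = CARD('a)"
    by (subst diff_conv_add_uminus, subst degree_add_eq_left) (simp_all add: degree_monom_eq)
  with \<open>CARD('a) > 1\<close> have "?p \<noteq> 0" by auto
  then have "finite {y. poly ?p y = 0}" and "card {y. poly ?p y = 0} \<le> CARD('a)"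
    using card_poly_roots_bound[of ?p] poly_roots_finite[of ?p] unfolding deg by blast+
  moreover have "card (range (to_ac :: 'a \<Rightarrow> _)) = CARD('a)"
    by (simp add: card_image inj_to_ac)
  moreover have "range to_ac \<subseteq> {y. poly ?p y = 0}"
    by (auto simp: poly_monom finite_field_power_CARD simp flip: to_ac_power)
  ultimately have "range to_ac = {y. poly ?p y = 0}"
    by (intro card_seteq) auto
  then show ?thesis by (auto simp: poly_monom)
qed

context
  fixes m :: nat
  assumes CARD: "CARD('a :: {field, finite}) = CHAR('a) ^ m"
begin

lemma alg_closure_sum_power_CARD:
  fixes h :: "'b \<Rightarrow> 'a alg_closure"
  shows "(\<Sum>x\<in>A. h x) ^ CARD('a) = (\<Sum>x\<in>A. h x ^ CARD('a))"
proof (rule freshmans_dream_sum')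
  show "Factorial_Ring.prime CHAR('a alg_closure)"
    by (simp add: prime_CHAR_semidom finite_imp_CHAR_pos)
qed (simp add: CARD)

text \<open>Frobenius is additive and multiplicative and fixes the coefficients of \<open>G\<close>,
  so it acts on the argument alone.\<close>

lemma poly_to_ac_power_CARD:
  fixes G :: "'a poly"
  shows "poly (map_poly to_ac G) x ^ CARD('a) = poly (map_poly to_ac G) (x ^ CARD('a))"
  unfolding poly_altdef alg_closure_sum_power_CARD
  by (simp add: power_mult_distrib finite_field_power_CARD mult.commute
      flip: to_ac_power power_mult)

text \<open>Frobenius sends each summand to the next and the last to the first, so the sum is a
  fixed point and lies in the ground field.\<close>

lemma orbit_sum_in_range_to_ac:
  fixes G :: "'a poly"
  assumes "\<gamma> \<in> ext_field l"
  shows "(\<Sum>\<iota><l. \<gamma> ^ (j * CARD('a) ^ \<iota>) / poly (map_poly to_ac G) (\<gamma> ^ (CARD('a) ^ \<iota>)))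
    \<in> range to_ac"
proof -
  let ?q = "CARD('a)"
  define t where "t \<iota> = \<gamma> ^ (j * ?q ^ \<iota>) / poly (map_poly to_ac G) (\<gamma> ^ (?q ^ \<iota>))" for \<iota>
  have t_Suc: "t \<iota> ^ ?q = t (Suc \<iota>)" for \<iota>
    by (simp add: t_def power_divide poly_to_ac_power_CARD ac_simps flip: power_mult)
  have \<gamma>: "\<gamma> ^ (?q ^ l) = \<gamma>"
    using assms by (simp add: ext_field_def)
  then have "t l = t 0"
    by (simp add: t_def mult.commute[of j] power_mult)
  have "(\<Sum>\<iota><l. t \<iota>) ^ ?q = (\<Sum>\<iota><l. t (Suc \<iota>))"
    by (simp add: alg_closure_sum_power_CARD t_Suc)
  also have "\<dots> = (\<Sum>\<iota><l. t \<iota>)"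
    using \<open>t l = t 0\<close> sum.lessThan_Suc_shift[of t l] by simp
  finally show ?thesis
    by (simp add: range_to_ac_iff t_def)
qed

end

text \<open>The characteristic is a prime dividing the order \<open>2 ^ m\<close> of the
  field.\<close>

lemma CHAR_eq_2:
  assumes "CARD('a :: {field, finite}) = 2 ^ m"
  shows "CHAR('a) = 2"
proof -
  have "Factorial_Ring.prime CHAR('a)"
    by (simp add: prime_CHAR_semidom finite_imp_CHAR_pos)
  moreover have "CHAR('a) dvd 2 ^ m"
    using CHAR_dvd_CARD[where 'a = 'a] assms by simp
  ultimately show ?thesis
    by (metis prime_dvd_power primes_dvd_imp_eq two_is_prime_nat)
qed

section \<open>The parity-check matrix\<close>

lemma generalized_goppa_code_iff:
  fixes G :: "'a :: {field, finite} poly" and f :: "nat \<Rightarrow> 'a poly"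
    and \<gamma> :: "nat \<Rightarrow> 'a alg_closure"
  assumes deg: "degree G > 0"
    and cop: "\<And>i. i < n \<Longrightarrow> coprime (f i) G"
    and split: "\<And>i. i < n \<Longrightarrow>
      map_poly to_ac (f i) = (\<Prod>j<degree (f i). [:- (\<gamma> i ^ (CARD('a) ^ j)), 1:])"
    and c: "c \<in> carrier_vec n"
  shows "c \<in> generalized_goppa_code n f G \<longleftrightarrow>
    goppa_matrix (degree G) n f \<gamma> G *\<^sub>v map_vec of_bit c = 0\<^sub>v (degree G)"
proof -
  interpret map_ac: map_poly_inj_idom_hom "to_ac :: 'a \<Rightarrow> 'a alg_closure" ..
  let ?g = "map_poly to_ac G" and ?q = "CARD('a)"
  let ?a = "\<lambda>i j. \<gamma> i ^ (?q ^ j)"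
  let ?b = "\<lambda>i. of_bit (c $ i) :: 'a alg_closure"
  let ?u = "\<lambda>i. inverse_mod G (f i)"
  \<comment> \<open>Pairs of a locator and one of its roots, so that all roots form a single indexed
    family.\<close>
  let ?X = "SIGMA i:{..<n}. {..<degree (f i)}"
  define w where "w = (\<lambda>(i, j). ?b i / poly ?g (?a i j))"
  define a where "a = (\<lambda>(i, j). ?a i j)"
  define S where "S = (\<Sum>i<n. smult (of_bit (c $ i)) (pderiv (f i) * ?u i))"
  define P where "P = (\<Sum>x\<in>?X. smult (w x) (synthetic_div ?g (a x)))"
  have inv: "[map_poly to_ac (f i) * map_poly to_ac (?u i) = 1] (mod ?g)" if "i < n" for i
    using map_ac.hom_dvd[of G "f i * ?u i - 1"] cong_inverse_mod[OF cop[OF that]]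
    by (simp add: cong_iff_dvd_diff map_ac.hom_minus map_ac.hom_mult)
  \<comment> \<open>If \<open>?g\<close> vanished at a root of \<open>f i\<close>, evaluating the
    inverse congruence there would give \<open>-1 = 0\<close>.\<close>
  have nz: "poly ?g (?a i j) \<noteq> 0" if ij: "i < n" "j < degree (f i)" for i j
  proof
    assume 0: "poly ?g (?a i j) = 0"
    obtain k where "map_poly to_ac (f i) * map_poly to_ac (?u i) - 1 = ?g * k"
      using inv[OF ij(1)] unfolding cong_iff_dvd_diff by (rule dvdE)
    then have "poly (map_poly to_ac (f i) * map_poly to_ac (?u i) - 1) (?a i j) =
        poly (?g * k) (?a i j)" by simp
    moreover have "poly (map_poly to_ac (f i)) (?a i j) = 0"
      using ij by (auto simp: split poly_prod)
    ultimately show False using 0 by simp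
  qed
  have "map_poly to_ac S =
      (\<Sum>i<n. [:?b i:] * (pderiv (map_poly to_ac (f i)) * map_poly to_ac (?u i)))"
    by (simp add: S_def map_ac.hom_sum map_ac.hom_mult to_ac.map_poly_hom_smult
        to_ac.map_poly_pderiv)
  also have "[\<dots> = (\<Sum>i<n. [:?b i:] *
      - (\<Sum>j<degree (f i). smult (1 / poly ?g (?a i j)) (synthetic_div ?g (?a i j))))] (mod ?g)"
    by (intro cong_sum cong_scalar_left pderiv_mult_inverse_cong split inv nz) simp_all
  also have "(\<Sum>i<n. [:?b i:] *
      - (\<Sum>j<degree (f i). smult (1 / poly ?g (?a i j)) (synthetic_div ?g (?a i j)))) = - P"
    by (simp add: P_def w_def a_def sum_negf smult_sum2 sum.Sigma split_def)
  finally have cong: "[map_poly to_ac S = - P] (mod ?g)" .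
  have "c \<in> generalized_goppa_code n f G \<longleftrightarrow> G dvd S"
    using c by (simp add: generalized_goppa_code_def S_def cong_0_iff)
  \<comment> \<open>Divisibility is preserved and reflected by the field embedding, so the test may
    be made where the locators split.\<close>
  also have "\<dots> \<longleftrightarrow> ?g dvd map_poly to_ac S"
    using to_ac.dvd_map_poly_hom_imp_dvd map_ac.hom_dvd by blast
  also have "\<dots> \<longleftrightarrow> ?g dvd P"
    using cong_dvd_iff[of "map_poly to_ac S" "- P" ?g] cong
    by (metis cong_0_iff cong_trans cong_sym dvd_minus_iff)
  also have "\<dots> \<longleftrightarrow> P = 0"
    using degree_sum_synthetic_div_less[of ?g w a ?X] deg dvd_imp_degree_le[of ?g P]
    by (auto simp: P_def)
  also have "\<dots> \<longleftrightarrow> (\<forall>j<degree G. (\<Sum>x\<in>?X. w x * a x ^ j) = 0)"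
    using sum_synthetic_div_eq_0_iff[of ?g w a ?X] deg by (simp add: P_def)
  also have "\<dots> \<longleftrightarrow>
      goppa_matrix (degree G) n f \<gamma> G *\<^sub>v map_vec of_bit c = 0\<^sub>v (degree G)"
  proof -
    have "(goppa_matrix (degree G) n f \<gamma> G *\<^sub>v map_vec of_bit c) $ k = (\<Sum>x\<in>?X. w x * a x ^ k)"
      if "k < degree G" for k
    proof -
      have "(goppa_matrix (degree G) n f \<gamma> G *\<^sub>v map_vec of_bit c) $ k =
          (\<Sum>i<n. (\<Sum>j<degree (f i). \<gamma> i ^ (k * ?q ^ j) / poly ?g (?a i j)) * ?b i)"
        using that c by (auto simp: goppa_matrix_def scalar_prod_def atLeast0LessThan)
      also have "\<dots> = (\<Sum>i<n. \<Sum>j<degree (f i). ?b i / poly ?g (?a i j) * ?a i j ^ k)"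
        by (simp add: sum_distrib_right sum_distrib_left ac_simps flip: power_mult)
      also have "\<dots> = (\<Sum>x\<in>?X. w x * a x ^ k)"
        by (simp add: w_def a_def sum.Sigma split_def)
      finally show ?thesis .
    qed
    moreover have "dim_row (goppa_matrix (degree G) n f \<gamma> G) = degree G"
      by (simp add: goppa_matrix_def)
    ultimately show ?thesis by (auto simp: vec_eq_iff)
  qed
  finally show ?thesis .
qed

theorem theorem1:
  fixes m n r q :: nat
    and G :: "'a :: {field, finite} poly"
    and f :: "nat \<Rightarrow> 'a poly"
    and \<gamma> :: "nat \<Rightarrow> 'a alg_closure"
  assumes "m > 0" and "n > 0" and "r > 0"
    and "r * m \<le> n"
    and "q = 2 ^ m" and "CARD('a) = q"
    and "degree G = r"
    and "\<And>i. i < n \<Longrightarrow> Factorial_Ring.irreducible (f i)"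
    and "\<And>i j. i < n \<Longrightarrow> j < n \<Longrightarrow> i \<noteq> j \<Longrightarrow> coprime (f i) (f j)"
    and "\<And>i. i < n \<Longrightarrow> coprime (f i) G"
    and "\<And>i j. i < n \<Longrightarrow> j < degree (f i) \<Longrightarrow> \<gamma> i ^ (q ^ j) \<in> ext_field (degree (f i))"
    and "\<And>i. i < n \<Longrightarrow> map_poly to_ac (f i) = (\<Prod>j<degree (f i). [:- (\<gamma> i ^ (q ^ j)), 1:])"
  shows "elements_mat (goppa_matrix r n f \<gamma> G) \<subseteq> range to_ac \<and>
    (\<forall>c \<in> carrier_vec n.
       c \<in> generalized_goppa_code n f G \<longleftrightarrow>
       goppa_matrix r n f \<gamma> G *\<^sub>v map_vec of_bit c = 0\<^sub>v r)"
proof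
  have CARD: "CARD('a) = CHAR('a) ^ m"
    using CHAR_eq_2[where 'a = 'a] assms by simp
  have "\<gamma> i \<in> ext_field (degree (f i))" if "i < n" for i
  proof -
    \<comment> \<open>Positivity makes the index \<open>0\<close> available, where the hypothesis on
      the roots speaks of \<open>\<gamma> i\<close> itself.\<close>
    have "degree (f i) > 0"
      using assms(8)[OF that] by (auto simp: Factorial_Ring.irreducible_def is_unit_iff_degree)
    then show ?thesis using assms(11)[OF that, of 0] by simp
  qed
  then show "elements_mat (goppa_matrix r n f \<gamma> G) \<subseteq> range to_ac"
    by (auto simp: elements_mat_def goppa_matrix_def intro!: orbit_sum_in_range_to_ac[OF CARD])
  show "\<forall>c \<in> carrier_vec n. c \<in> generalized_goppa_code n f G \<longleftrightarrow>
      goppa_matrix r n f \<gamma> G *\<^sub>v map_vec of_bit c = 0\<^sub>v r"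
    using generalized_goppa_code_iff[of G n f \<gamma>] assms by simp
qed

end
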